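(* Let $a<b$ be fixed real numbers. Let $f_1,f_2\in C^2([a,b])$ satisfy $f_1(a)=f_2(a)=f_1(b)=f_2(b)=0$ and $f_2(x)>f_1(x)$ for all $x\in(a,b)$, with $f_1$ convex and $f_2$ concave. For $\epsilon>0$ let $$\Omega_\epsilon=\{(x,y)\in\mathbb{R}^2:\ \epsilon f_1(x)<y<\epsilon f_2(x),\ x\in(a,b)\}.$$ Let $I\subset(a,b)$ be the (possibly degenerate, i.e. one-point) set on which $f_2-f_1$ achieves its maximum over $[a,b]$. Then the distance between the $x$-coordinates of fail points on $\partial\Omega_\epsilon$ and the set $I$ converges to $0$ as $\epsilon\to0^+$; that is, for every $\eta>0$ there is $\epsilon_0>0$ such that for all $0<\epsilon<\epsilon_0$, every fail point $(x,y)\in\partial\Omega_\epsilon$ of $\Omega_\epsilon$ satisfies $\operatorname{dist}(x,I)<\eta$.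
   Context: The torsion function $u_\epsilon$ of $\Omega_\epsilon$ is the unique solution of $-\Delta u_\epsilon=1$ in $\Omega_\epsilon$, $u_\epsilon=0$ on $\partial\Omega_\epsilon$; it is $C^1$ up to the boundary. A fail point on $\partial\Omega_\epsilon$ is a point of $\partial\Omega_\epsilon$ at which $|\nabla u_\epsilon|$ attains its maximum over $\partial\Omega_\epsilon$ (equivalently over $\overline{\Omega_\epsilon}$). *)

theory Defs
  imports "HOL-Analysis.Analysis"
begin

text \<open>Derivatives at the end points of \<open>[a,b]\<close> are one-sided.\<close>

definition C2_on_Icc :: "real \<Rightarrow> real \<Rightarrow> (real \<Rightarrow> real) \<Rightarrow> bool" where
  "C2_on_Icc a b f \<longleftrightarrow>
     (\<exists>f' f''. (\<forall>x\<in>{a..b}. (f has_real_derivative f' x) (at x within {a..b})) \<and>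
               (\<forall>x\<in>{a..b}. (f' has_real_derivative f'' x) (at x within {a..b})) \<and>
               continuous_on {a..b} f'')"

definition thin_domain ::
  "real \<Rightarrow> real \<Rightarrow> (real \<Rightarrow> real) \<Rightarrow> (real \<Rightarrow> real) \<Rightarrow> real \<Rightarrow> (real \<times> real) set" where
  "thin_domain a b f1 f2 \<epsilon> =
     {(x, y). a < x \<and> x < b \<and> \<epsilon> * f1 x < y \<and> y < \<epsilon> * f2 x}"

definition argmax_set :: "'a set \<Rightarrow> ('a \<Rightarrow> real) \<Rightarrow> 'a set" where
  "argmax_set S g = {x \<in> S. \<forall>z\<in>S. g z \<le> g x}"

text \<open>
  Classical solutions, twice continuously differentiable in \<open>\<Omega>\<close> and continuous on its closure,
  of the Dirichlet problem for \<open>-\<Delta>u = 1\<close>.  Here \<open>G\<close> is the gradient of \<open>u\<close>, \<open>H\<close> its derivative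
  (the Hessian), and \<open>\<Delta>u\<close> is the trace of \<open>H\<close>.  For bounded open \<open>\<Omega>\<close> there is at most one
  such \<open>u\<close> (up to its values off the closure of \<open>\<Omega>\<close>), by the maximum principle.
\<close>

definition torsion_function :: "'a::euclidean_space set \<Rightarrow> ('a \<Rightarrow> real) \<Rightarrow> bool" where
  "torsion_function \<Omega> u \<longleftrightarrow>
     continuous_on (closure \<Omega>) u \<and>
     (\<forall>p\<in>frontier \<Omega>. u p = 0) \<and>
     (\<exists>(G :: 'a \<Rightarrow> 'a) (H :: 'a \<Rightarrow> ('a \<Rightarrow>\<^sub>L 'a)).
        continuous_on \<Omega> H \<and>
        (\<forall>p\<in>\<Omega>. GDERIV u p :> G p \<and>
                (G has_derivative blinfun_apply (H p)) (at p) \<and>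
                - (\<Sum>e\<in>Basis. blinfun_apply (H p) e \<bullet> e) = 1))"

text \<open>
  \<open>u\<close> is \<open>C\<^sup>1\<close> up to the boundary, and \<open>G\<close> is its gradient: on the frontier, \<open>\<nabla>u\<close> means the
  continuous extension of the gradient from \<open>\<Omega>\<close>, so the values of \<open>u\<close> outside the closure
  play no role.
\<close>

definition gradient_up_to_boundary ::
  "'a::euclidean_space set \<Rightarrow> ('a \<Rightarrow> real) \<Rightarrow> ('a \<Rightarrow> 'a) \<Rightarrow> bool" where
  "gradient_up_to_boundary \<Omega> u G \<longleftrightarrow>
     (\<forall>p\<in>\<Omega>. GDERIV u p :> G p) \<and> continuous_on (closure \<Omega>) G"

text \<open>For bounded open \<open>\<Omega>\<close>, \<open>u\<close> and \<open>G\<close> are uniquely determined on the closure of \<open>\<Omega>\<close>.\<close>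

definition fail_point :: "'a::euclidean_space set \<Rightarrow> 'a \<Rightarrow> bool" where
  "fail_point \<Omega> p \<longleftrightarrow>
     (\<exists>u G. torsion_function \<Omega> u \<and> gradient_up_to_boundary \<Omega> u G \<and>
            p \<in> frontier \<Omega> \<and> (\<forall>q\<in>frontier \<Omega>. norm (G q) \<le> norm (G p)))"

end

theory Submission
  imports Defs
begin

text \<open>
  The function \<open>V(x,y) = (\<epsilon> f\<^sub>2(x) - y)(y - \<epsilon> f\<^sub>1(x))\<close> vanishes on the boundary of the thin domain
  and satisfies \<open>\<Delta>V = -2 + O(\<epsilon>\<^sup>2)\<close>, so by the maximum principle \<open>u\<close> lies between two multiples
  \<open>(1 + O(\<epsilon>\<^sup>2)) V/2\<close>.  As these all vanish on the boundary, the size of \<open>\<nabla>u\<close> there is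
  \<open>(1 + O(\<epsilon>\<^sup>2)) |\<nabla>V|/2 = \<epsilon> (f\<^sub>2 - f\<^sub>1)/2 + O(\<epsilon>\<^sup>2)\<close>.  A fail point therefore has \<open>f\<^sub>2 - f\<^sub>1\<close> close to
  its maximum, and compactness of \<open>[a,b]\<close> concludes.
\<close>

section \<open>Second derivatives along lines and the weak maximum principle\<close>

text \<open>A pointwise notion: the first derivative exists near \<open>x\<close>, the second only
  at \<open>x\<close>. This is exactly what the second-derivative test uses, and it suits slices of
  \<open>u\<close>, which are differentiable only as long as they stay inside the domain.\<close>

definition has_deriv2 :: "(real \<Rightarrow> real) \<Rightarrow> real \<Rightarrow> real \<Rightarrow> bool" where
  "has_deriv2 g h x \<longleftrightarrow>
     (\<exists>g'. (\<forall>\<^sub>F s in nhds x. (g has_real_derivative g' s) (at s)) \<and>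
           (g' has_real_derivative h) (at x))"

lemma has_deriv2_lincomb:
  assumes "has_deriv2 g h x" "has_deriv2 k l x"
  shows "has_deriv2 (\<lambda>s. c * g s + d * k s) (c * h + d * l) x"
proof -
  obtain g' k' where
    g: "\<forall>\<^sub>F s in nhds x. (g has_real_derivative g' s) (at s)" "(g' has_real_derivative h) (at x)" and
    k: "\<forall>\<^sub>F s in nhds x. (k has_real_derivative k' s) (at s)" "(k' has_real_derivative l) (at x)"
    using assms unfolding has_deriv2_def by blast
  have "\<forall>\<^sub>F s in nhds x. ((\<lambda>s. c * g s + d * k s) has_real_derivative (c * g' s + d * k' s)) (at s)"
    using g(1) k(1) by eventually_elim (auto intro!: derivative_eq_intros)
  moreover have "((\<lambda>s. c * g' s + d * k' s) has_real_derivative (c * h + d * l)) (at x)"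
    using g(2) k(2) by (auto intro!: derivative_eq_intros)
  ultimately show ?thesis unfolding has_deriv2_def by (intro exI conjI)
qed

text \<open>At a local maximum \<open>g'\<close> vanishes. If \<open>h\<close> were positive,
  \<open>g'\<close> would be positive just to the right of \<open>x\<close>, and the mean value
  theorem would produce values of \<open>g\<close> above \<open>g x\<close>.\<close>

lemma local_max_deriv2_le_0:
  assumes "has_deriv2 g h x" and max: "\<forall>\<^sub>F s in nhds x. g s \<le> g x"
  shows "h \<le> 0"
proof (rule ccontr)
  assume "\<not> h \<le> 0"
  obtain g' where
    g: "\<forall>\<^sub>F s in nhds x. (g has_real_derivative g' s) (at s)" "(g' has_real_derivative h) (at x)"
    using assms(1) unfolding has_deriv2_def by blast
  obtain d where d: "d > 0" "\<And>s. dist s x < d \<Longrightarrow> (g has_real_derivative g' s) (at s) \<and> g s \<le> g x"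
    using eventually_conj[OF g(1) max] unfolding eventually_nhds_metric by blast
  have "g' x = 0"
    by (rule DERIV_local_max[of g _ x d]) (use d in \<open>auto simp: dist_real_def abs_minus_commute\<close>)
  then obtain e where e: "e > 0" "\<And>t. 0 < t \<Longrightarrow> t < e \<Longrightarrow> g' (x + t) > 0"
    using DERIV_pos_inc_right[OF g(2)] \<open>\<not> h \<le> 0\<close> by auto
  define t where "t = min d e / 2"
  have t: "0 < t" "t < d" "t < e" using d(1) e(1) by (auto simp: t_def)
  have "\<exists>z. x < z \<and> z < x + t \<and> g (x + t) - g x = (x + t - x) * g' z"
    by (rule MVT2) (use t d in \<open>auto simp: dist_real_def\<close>)
  then obtain z where z: "x < z" "z < x + t" "g (x + t) - g x = t * g' z"
    by auto
  have "g' z > 0" using e(2)[of "z - x"] z t by auto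
  then have "g (x + t) > g x" using z(3) t by (smt (verit) mult_pos_pos)
  moreover have "g (x + t) \<le> g x" using d(2)[of "x + t"] t by (auto simp: dist_real_def)
  ultimately show False by simp
qed

text \<open>The maximum over the compact closure cannot sit inside \<open>\<Omega>\<close>: both
  axis-parallel slices would have a local maximum there, so \<open>h1\<close> and \<open>h2\<close>
  would be at most 0, against their strictly positive sum. Asking for strict positivity avoids the
  usual perturbation argument, and the Laplacian enters only through second derivatives of
  slices.\<close>

lemma weak_maximum_principle:
  fixes \<Omega> :: "(real \<times> real) set"
  assumes "open \<Omega>" "bounded \<Omega>" and cont: "continuous_on (closure \<Omega>) \<phi>"
    and bd: "\<And>p. p \<in> frontier \<Omega> \<Longrightarrow> \<phi> p \<le> 0"
    and lap: "\<And>x y. (x, y) \<in> \<Omega> \<Longrightarrow> \<exists>h1 h2. has_deriv2 (\<lambda>s. \<phi> (s, y)) h1 x \<and>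
                 has_deriv2 (\<lambda>s. \<phi> (x, s)) h2 y \<and> h1 + h2 > 0"
    and "p \<in> \<Omega>"
  shows "\<phi> p \<le> 0"
proof -
  have "compact (closure \<Omega>)" using \<open>bounded \<Omega>\<close> by auto
  moreover have "p \<in> closure \<Omega>" using \<open>p \<in> \<Omega>\<close> closure_subset by auto
  ultimately obtain q where q: "q \<in> closure \<Omega>" "\<And>z. z \<in> closure \<Omega> \<Longrightarrow> \<phi> z \<le> \<phi> q"
    using continuous_attains_sup[OF _ _ cont] by (metis empty_iff)
  have "q \<notin> \<Omega>"
  proof
    assume "q \<in> \<Omega>"
    obtain x y where xy: "q = (x, y)" by fastforce
    obtain h1 h2 where h: "has_deriv2 (\<lambda>s. \<phi> (s, y)) h1 x" "has_deriv2 (\<lambda>s. \<phi> (x, s)) h2 y"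
      "h1 + h2 > 0" using lap \<open>q \<in> \<Omega>\<close> xy by blast
    have ev: "\<forall>\<^sub>F z in nhds q. \<phi> z \<le> \<phi> q"
      using eventually_nhds_in_open[OF \<open>open \<Omega>\<close> \<open>q \<in> \<Omega>\<close>]
      by eventually_elim (use q closure_subset in blast)
    have "filterlim (\<lambda>s. (s, y)) (nhds q) (nhds x)" "filterlim (\<lambda>s. (x, s)) (nhds q) (nhds y)"
      unfolding xy by (intro tendsto_intros filterlim_ident)+
    then have "\<forall>\<^sub>F s in nhds x. \<phi> (s, y) \<le> \<phi> (x, y)" "\<forall>\<^sub>F s in nhds y. \<phi> (x, s) \<le> \<phi> (x, y)"
      using ev unfolding filterlim_iff xy by auto
    with h show False
      using local_max_deriv2_le_0[OF h(1)] local_max_deriv2_le_0[OF h(2)] by auto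
  qed
  then have "q \<in> frontier \<Omega>" using q(1) \<open>open \<Omega>\<close> by (simp add: frontier_def interior_open)
  then show ?thesis using bd q(2)[OF \<open>p \<in> closure \<Omega>\<close>] by fastforce
qed

text \<open>Translates the Hessian formulation of the equation into slices: by the chain rule the
  second derivatives along the two axes are the diagonal entries of \<open>H p\<close>, and the
  trace condition gives their sum.\<close>

lemma torsion_function_deriv2:
  fixes \<Omega> :: "(real \<times> real) set"
  assumes "open \<Omega>" "torsion_function \<Omega> u" "(x, y) \<in> \<Omega>"
  obtains h1 h2 where "has_deriv2 (\<lambda>s. u (s, y)) h1 x" "has_deriv2 (\<lambda>s. u (x, s)) h2 y"
    "h1 + h2 = - 1"
proof -
  obtain G :: "real \<times> real \<Rightarrow> real \<times> real" and H :: "real \<times> real \<Rightarrow> (real \<times> real) \<Rightarrow>\<^sub>L (real \<times> real)" where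
    GH: "\<And>p. p \<in> \<Omega> \<Longrightarrow> GDERIV u p :> G p"
    "\<And>p. p \<in> \<Omega> \<Longrightarrow> (G has_derivative blinfun_apply (H p)) (at p)"
    "\<And>p. p \<in> \<Omega> \<Longrightarrow> - (\<Sum>e\<in>Basis. blinfun_apply (H p) e \<bullet> e) = 1"
    using assms(2) unfolding torsion_function_def by blast
  define p where "p = (x, y)"
  have ev: "\<forall>\<^sub>F z in nhds p. z \<in> \<Omega>"
    using eventually_nhds_in_open[OF \<open>open \<Omega>\<close>] assms(3) p_def by blast
  have "filterlim (\<lambda>s. (s, y)) (nhds p) (nhds x)" "filterlim (\<lambda>s. (x, s)) (nhds p) (nhds y)"
    unfolding p_def by (intro tendsto_intros filterlim_ident)+
  then have evx: "\<forall>\<^sub>F s in nhds x. (s, y) \<in> \<Omega>" and evy: "\<forall>\<^sub>F s in nhds y. (x, s) \<in> \<Omega>"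
    using ev unfolding filterlim_iff by auto
  have px: "((\<lambda>s. (s, y)) has_derivative (\<lambda>h. (h, 0))) (at s)" for s :: real
    by (auto intro!: derivative_eq_intros)
  have py: "((\<lambda>s. (x, s)) has_derivative (\<lambda>h. (0, h))) (at s)" for s :: real
    by (auto intro!: derivative_eq_intros)
  have "has_deriv2 (\<lambda>s. u (s, y)) (fst (blinfun_apply (H p) (1, 0))) x"
    unfolding has_deriv2_def
  proof (intro exI conjI)
    show "\<forall>\<^sub>F s in nhds x. ((\<lambda>s. u (s, y)) has_real_derivative fst (G (s, y))) (at s)"
      using evx
    proof eventually_elim
      case (elim s)
      show ?case
        using has_derivative_compose[OF px GH(1)[OF elim, unfolded gderiv_def]]
        by (simp add: has_field_derivative_def inner_prod_def mult.commute[of _ "fst _"])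
    qed
    have "((\<lambda>s. G (s, y)) has_derivative (\<lambda>h. blinfun_apply (H p) (h, 0))) (at x)"
      using has_derivative_compose[OF px GH(2)[OF assms(3)]] by (simp add: p_def)
    then have "((\<lambda>s. fst (G (s, y))) has_derivative (\<lambda>h. fst (blinfun_apply (H p) (h, 0)))) (at x)"
      by (rule has_derivative_fst)
    moreover have "(\<lambda>h. fst (blinfun_apply (H p) (h, 0))) = (*) (fst (blinfun_apply (H p) (1, 0)))"
    proof
      fix h :: real
      show "fst (blinfun_apply (H p) (h, 0)) = fst (blinfun_apply (H p) (1, 0)) * h"
        using blinfun.scaleR_right[of "H p" h "(1, 0)"] by simp
    qed
    ultimately show "((\<lambda>s. fst (G (s, y))) has_real_derivative fst (blinfun_apply (H p) (1, 0))) (at x)"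
      by (simp add: has_field_derivative_def)
  qed
  moreover have "has_deriv2 (\<lambda>s. u (x, s)) (snd (blinfun_apply (H p) (0, 1))) y"
    unfolding has_deriv2_def
  proof (intro exI conjI)
    show "\<forall>\<^sub>F s in nhds y. ((\<lambda>s. u (x, s)) has_real_derivative snd (G (x, s))) (at s)"
      using evy
    proof eventually_elim
      case (elim s)
      show ?case
        using has_derivative_compose[OF py GH(1)[OF elim, unfolded gderiv_def]]
        by (simp add: has_field_derivative_def inner_prod_def mult.commute[of _ "snd _"])
    qed
    have "((\<lambda>s. G (x, s)) has_derivative (\<lambda>h. blinfun_apply (H p) (0, h))) (at y)"
      using has_derivative_compose[OF py GH(2)[OF assms(3)]] by (simp add: p_def)
    then have "((\<lambda>s. snd (G (x, s))) has_derivative (\<lambda>h. snd (blinfun_apply (H p) (0, h)))) (at y)"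
      by (rule has_derivative_snd)
    moreover have "(\<lambda>h. snd (blinfun_apply (H p) (0, h))) = (*) (snd (blinfun_apply (H p) (0, 1)))"
    proof
      fix h :: real
      show "snd (blinfun_apply (H p) (0, h)) = snd (blinfun_apply (H p) (0, 1)) * h"
        using blinfun.scaleR_right[of "H p" h "(0, 1)"] by simp
    qed
    ultimately show "((\<lambda>s. snd (G (x, s))) has_real_derivative snd (blinfun_apply (H p) (0, 1))) (at y)"
      by (simp add: has_field_derivative_def)
  qed
  moreover have "fst (blinfun_apply (H p) (1, 0)) + snd (blinfun_apply (H p) (0, 1)) = - 1"
  proof -
    have B: "(Basis :: (real \<times> real) set) = {(1, 0), (0, 1)}"
      by (auto simp: Basis_prod_def)
    show ?thesis using GH(3)[of p] assms(3) unfolding p_def B by (simp add: inner_prod_def)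
  qed
  ultimately show ?thesis by (rule that)
qed

section \<open>Boundary gradients squeezed between two barriers\<close>

text \<open>
  Along a direction \<open>e\<close> with \<open>e \<bullet> N > 0\<close> the segment from \<open>p\<close> enters \<open>\<Omega>\<close>, which compares \<open>e \<bullet> G p\<close>
  with \<open>e \<bullet> N\<close>; the two estimates follow from \<open>e = N\<close> and \<open>e = G p\<close>.
\<close>

lemma boundary_gradient_bounds:
  fixes \<Omega> :: "'a::euclidean_space set"
  assumes "open \<Omega>" and grad: "gradient_up_to_boundary \<Omega> u G" and u: "continuous_on (closure \<Omega>) u"
    and p: "p \<in> closure \<Omega>" "u p = 0"
    and V: "GDERIV V p :> N" "V p = 0" "N \<noteq> 0"
    and pos: "\<forall>\<^sub>F q in nhds p. V q > 0 \<longrightarrow> q \<in> \<Omega>"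
    and bounds: "\<And>q. q \<in> \<Omega> \<Longrightarrow> c * V q \<le> u q" "\<And>q. q \<in> \<Omega> \<Longrightarrow> u q \<le> d * V q"
    and "c > 0"
  shows "c * norm N \<le> norm (G p)" and "norm (G p) \<le> d * norm N"
proof -
  have key: "c * (e \<bullet> N) \<le> e \<bullet> G p \<and> e \<bullet> G p \<le> d * (e \<bullet> N)" if e: "e \<bullet> N > 0" for e
  proof -
    define l where "l s = p + s *\<^sub>R e" for s :: real
    have l0: "l 0 = p" by (simp add: l_def)
    have l': "(l has_derivative (\<lambda>h. h *\<^sub>R e)) (at s)" for s
      unfolding l_def by (auto intro!: derivative_eq_intros)
    have lc: "isCont l s" for s using l' has_derivative_continuous by blast
    have "((\<lambda>s. V (l s)) has_derivative (\<lambda>h. (h *\<^sub>R e) \<bullet> N)) (at 0)"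
      using has_derivative_compose[OF l', of V "\<lambda>h. h \<bullet> N" 0] V(1) unfolding gderiv_def by (simp add: l0)
    then have VD: "((\<lambda>s. V (l s)) has_real_derivative (e \<bullet> N)) (at 0)"
      by (simp add: has_field_derivative_def mult.commute[of _ "e \<bullet> N"])
    obtain r where r: "r > 0" "\<And>s. 0 < s \<Longrightarrow> s < r \<Longrightarrow> V (l s) > 0"
      using DERIV_pos_inc_right[OF VD e] by (auto simp: l0 V(2))
    have "filterlim l (nhds p) (nhds 0)"
      using lc[of 0] l0 by (metis isCont_def tendsto_at_iff_tendsto_nhds)
    then have "\<forall>\<^sub>F s in nhds 0. V (l s) > 0 \<longrightarrow> l s \<in> \<Omega>"
      using pos unfolding filterlim_iff by auto
    then obtain r' where r': "r' > 0" "\<And>s. dist s 0 < r' \<Longrightarrow> V (l s) > 0 \<longrightarrow> l s \<in> \<Omega>"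
      unfolding eventually_nhds_metric by blast
    define t where "t = min r r'"
    have t: "t > 0" "\<And>s. 0 < s \<Longrightarrow> s < t \<Longrightarrow> l s \<in> \<Omega>"
      using r r' by (auto simp: t_def)
    have cl: "l s \<in> closure \<Omega>" if "0 \<le> s" "s < t" for s
      using t(2)[of s] that p(1) l0 closure_subset[of \<Omega>] by (cases "s = 0") auto
    have tr: "\<forall>\<^sub>F s in at_right 0. s \<in> {0<..<t}"
      using t(1) eventually_at_right_real by blast
    have lim1: "((\<lambda>s. V (l s) / s) \<longlongrightarrow> e \<bullet> N) (at_right 0)"
      using VD unfolding DERIV_def
      by (simp add: l0 V(2) filterlim_at_split)
    have lr: "(l \<longlongrightarrow> p) (at_right 0)"
      using lc[of 0] l0 unfolding isCont_def by (simp add: filterlim_at_split)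
    have Gc: "((\<lambda>s. G (l s)) \<longlongrightarrow> G p) (at_right 0)"
    proof (rule continuous_on_tendsto_compose[OF _ lr p(1)])
      show "continuous_on (closure \<Omega>) G"
        using grad by (simp add: gradient_up_to_boundary_def)
      show "\<forall>\<^sub>F s in at_right 0. l s \<in> closure \<Omega>"
        using tr by eventually_elim (use cl in auto)
    qed
    \<comment> \<open>\<open>u\<close> is differentiated only at interior points of the segment; at
      \<open>p\<close> itself just its continuity is used. The difference quotient thus becomes a
      value of \<open>e \<bullet> G\<close> inside \<open>\<Omega>\<close>, and continuity of
      \<open>G\<close> up to the boundary yields its limit.\<close>
    have mv: "\<exists>z. 0 < z \<and> z < s \<and> u (l s) / s = e \<bullet> G (l z)" if s: "0 < s" "s < t" for s
    proof -
      have "continuous_on {0..s} (\<lambda>s. u (l s))"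
        by (rule continuous_on_compose2[OF u]) (use lc cl s in \<open>auto intro!: continuous_at_imp_continuous_on\<close>)
      moreover have "((\<lambda>s. u (l s)) has_derivative (\<lambda>h. h * (e \<bullet> G (l z)))) (at z)"
        if "0 < z" "z < s" for z
        using has_derivative_compose[OF l', of u "\<lambda>h. h \<bullet> G (l z)"] grad t(2)[of z] that s
        unfolding gradient_up_to_boundary_def gderiv_def by simp
      ultimately obtain z where "0 < z" "z < s" "u (l s) - u (l 0) = (s - 0) * (e \<bullet> G (l z))"
        using mvt[of 0 s "\<lambda>s. u (l s)" "\<lambda>z h. h * (e \<bullet> G (l z))"] s(1) by blast
      then show ?thesis using s p(2) by (auto simp: l0)
    qed
    have lim2: "((\<lambda>s. u (l s) / s) \<longlongrightarrow> e \<bullet> G p) (at_right 0)"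
    proof (rule tendstoI)
      fix \<delta> :: real assume "\<delta> > 0"
      have "((\<lambda>s. e \<bullet> G (l s)) \<longlongrightarrow> e \<bullet> G p) (at_right 0)"
        by (intro tendsto_intros Gc)
      then have "\<forall>\<^sub>F s in at_right 0. dist (e \<bullet> G (l s)) (e \<bullet> G p) < \<delta>"
        using \<open>\<delta> > 0\<close> by (rule tendstoD)
      then obtain b where b: "b > 0" "\<And>z. 0 < z \<Longrightarrow> z < b \<Longrightarrow> dist (e \<bullet> G (l z)) (e \<bullet> G p) < \<delta>"
        unfolding eventually_at_right_field by blast
      have "\<forall>\<^sub>F s in at_right 0. s \<in> {0<..<b}"
        using b(1) eventually_at_right_real by blast
      then show "\<forall>\<^sub>F s in at_right 0. dist (u (l s) / s) (e \<bullet> G p) < \<delta>"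
        using tr
      proof eventually_elim
        case (elim s)
        then obtain z where "0 < z" "z < s" "u (l s) / s = e \<bullet> G (l z)"
          using mv[of s] by auto
        then show ?case using b(2)[of z] elim by auto
      qed
    qed
    have "\<forall>\<^sub>F s in at_right 0. c * (V (l s) / s) \<le> u (l s) / s"
      using tr by eventually_elim (use bounds(1) t in \<open>auto simp: field_simps\<close>)
    then have 1: "c * (e \<bullet> N) \<le> e \<bullet> G p"
      using tendsto_le[OF _ lim2 tendsto_mult_left[OF lim1, of c]] by (simp)
    have "\<forall>\<^sub>F s in at_right 0. u (l s) / s \<le> d * (V (l s) / s)"
      using tr by eventually_elim (use bounds(2) t in \<open>auto simp: field_simps\<close>)
    then have 2: "e \<bullet> G p \<le> d * (e \<bullet> N)"
      using tendsto_le[OF _ tendsto_mult_left[OF lim1, of d] lim2] by (simp)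
    show ?thesis using 1 2 by simp
  qed
  have N: "norm N > 0" "N \<bullet> N > 0" using V(3) by auto
  have "c * (N \<bullet> N) \<le> N \<bullet> G p" using key N by blast
  then have 1: "c * norm N ^ 2 \<le> N \<bullet> G p" by (simp add: power2_norm_eq_inner)
  also have "\<dots> \<le> norm N * norm (G p)" by (rule norm_cauchy_schwarz)
  finally show "c * norm N \<le> norm (G p)" using N by (simp add: power2_eq_square)
  \<comment> \<open>The first estimate shows that \<open>G p\<close> is itself an admissible
    direction, so \<open>key\<close> may be applied with \<open>e = G p\<close>.\<close>
  have "G p \<bullet> N > 0" using 1 \<open>c > 0\<close> N by (smt (verit) inner_commute mult_pos_pos zero_less_power)
  then have "norm (G p) ^ 2 \<le> d * (G p \<bullet> N)" "0 < G p \<bullet> N"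
    using key[of "G p"] by (auto simp: power2_norm_eq_inner)
  moreover from this have "G p \<noteq> 0" by auto
  \<comment> \<open>The sign of \<open>d\<close> is read off from
    \<open>0 < norm (G p) ^ 2 \<le> d * (G p \<bullet> N)\<close>; it is what allows multiplying the
    Cauchy-Schwarz inequality by \<open>d\<close>.\<close>
  moreover from calculation have "d > 0"
    by (metis less_le_trans zero_less_norm_iff zero_less_power zero_less_mult_pos2)
  ultimately have "norm (G p) ^ 2 \<le> d * (norm (G p) * norm N)"
    using mult_left_mono[OF norm_cauchy_schwarz[of "G p" N], of d] by linarith
  then have "norm (G p) * norm (G p) \<le> norm (G p) * (d * norm N)"
    by (simp add: power2_eq_square mult.left_commute)
  then show "norm (G p) \<le> d * norm N" using \<open>G p \<noteq> 0\<close> by simp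
qed

section \<open>Geometry of the thin domain\<close>

text \<open>A single constant \<open>K\<close> bounds both profiles and their first two derivatives,
  so that every error term below is explicit in \<open>\<epsilon> * K\<close>.\<close>

locale thin_profile =
  fixes a b K :: real and f1 f1' f1'' f2 f2' f2'' :: "real \<Rightarrow> real"
  assumes ab: "a < b"
    and D1: "x \<in> {a..b} \<Longrightarrow> (f1 has_real_derivative f1' x) (at x within {a..b})"
    and D1': "x \<in> {a..b} \<Longrightarrow> (f1' has_real_derivative f1'' x) (at x within {a..b})"
    and D2: "x \<in> {a..b} \<Longrightarrow> (f2 has_real_derivative f2' x) (at x within {a..b})"
    and D2': "x \<in> {a..b} \<Longrightarrow> (f2' has_real_derivative f2'' x) (at x within {a..b})"
    and ends: "f1 a = 0" "f2 a = 0" "f1 b = 0" "f2 b = 0"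
    and less: "a < x \<Longrightarrow> x < b \<Longrightarrow> f1 x < f2 x"
    and K: "x \<in> {a..b} \<Longrightarrow> \<bar>f1 x\<bar> \<le> K" "x \<in> {a..b} \<Longrightarrow> \<bar>f1' x\<bar> \<le> K" "x \<in> {a..b} \<Longrightarrow> \<bar>f1'' x\<bar> \<le> K"
      "x \<in> {a..b} \<Longrightarrow> \<bar>f2 x\<bar> \<le> K" "x \<in> {a..b} \<Longrightarrow> \<bar>f2' x\<bar> \<le> K" "x \<in> {a..b} \<Longrightarrow> \<bar>f2'' x\<bar> \<le> K"
    and K_pos: "K > 0"
begin

abbreviation \<Omega> :: "real \<Rightarrow> (real \<times> real) set" where
  "\<Omega> \<equiv> thin_domain a b f1 f2"

definition V :: "real \<Rightarrow> real \<times> real \<Rightarrow> real" where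
  "V \<epsilon> p = (\<epsilon> * f2 (fst p) - snd p) * (snd p - \<epsilon> * f1 (fst p))"

lemma derivs:
  assumes "a < x" "x < b"
  shows "(f1 has_real_derivative f1' x) (at x)" "(f1' has_real_derivative f1'' x) (at x)"
    "(f2 has_real_derivative f2' x) (at x)" "(f2' has_real_derivative f2'' x) (at x)"
proof -
  have "at x within {a..b} = at x" "x \<in> {a..b}" using assms by (auto intro: at_within_Icc_at)
  then show "(f1 has_real_derivative f1' x) (at x)" "(f1' has_real_derivative f1'' x) (at x)"
    "(f2 has_real_derivative f2' x) (at x)" "(f2' has_real_derivative f2'' x) (at x)"
    using D1 D1' D2 D2' by metis+
qed

lemma cont: "continuous_on {a..b} f1" "continuous_on {a..b} f2"
  using D1 D2 DERIV_continuous_on by blast+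

lemma cont_strip:
  "continuous_on ({a..b} \<times> UNIV) (\<lambda>p. f1 (fst p))" "continuous_on ({a..b} \<times> UNIV) (\<lambda>p. f2 (fst p))"
  using continuous_on_compose2[OF cont(1) continuous_on_fst[OF continuous_on_id], of "{a..b} \<times> UNIV"]
    continuous_on_compose2[OF cont(2) continuous_on_fst[OF continuous_on_id], of "{a..b} \<times> UNIV"]
  by auto

lemma cont_V: "continuous_on ({a..b} \<times> UNIV) (V \<epsilon>)"
  unfolding V_def by (intro continuous_intros cont_strip)

text \<open>Over the open interval the two factors of \<open>V\<close> add up to the positive width
  \<open>\<epsilon> * (f2 x - f1 x)\<close>, so they cannot both be negative; a positive product
  therefore means that both are positive.\<close>

lemma mem_iff:
  assumes "\<epsilon> > 0"
  shows "p \<in> \<Omega> \<epsilon> \<longleftrightarrow> a < fst p \<and> fst p < b \<and> V \<epsilon> p > 0"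
proof (cases "a < fst p \<and> fst p < b")
  case True
  then have "\<epsilon> * f1 (fst p) < \<epsilon> * f2 (fst p)" using less assms by simp
  with True show ?thesis
    by (auto simp: thin_domain_def V_def zero_less_mult_iff case_prod_beta)
qed (auto simp: thin_domain_def)

lemma open_domain:
  assumes "\<epsilon> > 0"
  shows "open (\<Omega> \<epsilon>)"
proof -
  have "open (({a<..<b} \<times> UNIV) \<inter> V \<epsilon> -` {0<..})"
    by (rule continuous_open_preimage[OF continuous_on_subset[OF cont_V]]) (auto intro: open_Times)
  moreover have "\<Omega> \<epsilon> = ({a<..<b} \<times> UNIV) \<inter> V \<epsilon> -` {0<..}"
    using mem_iff[OF assms] by (auto simp: mem_Times_iff)
  ultimately show ?thesis by simp
qed

lemma closure_domain:
  assumes "p \<in> closure (\<Omega> \<epsilon>)"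
  shows "a \<le> fst p" "fst p \<le> b" "\<epsilon> * f1 (fst p) \<le> snd p" "snd p \<le> \<epsilon> * f2 (fst p)"
proof -
  let ?S = "{a..b} \<times> (UNIV :: real set)"
  let ?C = "(?S \<inter> (\<lambda>p. snd p - \<epsilon> * f1 (fst p)) -` {0..}) \<inter> (?S \<inter> (\<lambda>p. \<epsilon> * f2 (fst p) - snd p) -` {0..})"
  have "closed ?S" by (intro closed_Times) auto
  then have "closed ?C"
    by (intro closed_Int[OF continuous_closed_preimage continuous_closed_preimage]
        continuous_intros cont_strip)
  moreover have "\<Omega> \<epsilon> \<subseteq> ?C" by (auto simp: thin_domain_def)
  ultimately have "p \<in> ?C" using assms closure_minimal by blast
  then show "a \<le> fst p" "fst p \<le> b" "\<epsilon> * f1 (fst p) \<le> snd p" "snd p \<le> \<epsilon> * f2 (fst p)"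
    by (auto simp: mem_Times_iff)
qed

lemma bounded_domain:
  assumes "\<epsilon> > 0"
  shows "bounded (\<Omega> \<epsilon>)"
proof (rule bounded_subset)
  show "bounded ({a..b} \<times> {- \<epsilon> * K..\<epsilon> * K})" by (intro bounded_Times) auto
  show "\<Omega> \<epsilon> \<subseteq> {a..b} \<times> {- \<epsilon> * K..\<epsilon> * K}"
  proof clarify
    fix x y assume xy: "(x, y) \<in> \<Omega> \<epsilon>"
    then have "f2 x \<le> K" "- K \<le> f1 x" using K(1)[of x] K(4)[of x] by (auto simp: thin_domain_def)
    then have "\<epsilon> * f2 x \<le> \<epsilon> * K" "\<epsilon> * (- K) \<le> \<epsilon> * f1 x"
      using assms by (meson mult_left_mono less_imp_le)+
    then show "x \<in> {a..b} \<and> y \<in> {- \<epsilon> * K..\<epsilon> * K}"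
      using xy by (auto simp: thin_domain_def)
  qed
qed

lemma frontier_domain:
  assumes "\<epsilon> > 0" "(x, y) \<in> frontier (\<Omega> \<epsilon>)"
  shows "x \<in> {a..b}" "y = \<epsilon> * f1 x \<or> y = \<epsilon> * f2 x" "V \<epsilon> (x, y) = 0"
proof -
  have c: "(x, y) \<in> closure (\<Omega> \<epsilon>)" and n: "(x, y) \<notin> \<Omega> \<epsilon>"
    using assms open_domain[OF assms(1)] by (auto simp: frontier_def interior_open)
  show "x \<in> {a..b}" using closure_domain[OF c] by auto
  show "y = \<epsilon> * f1 x \<or> y = \<epsilon> * f2 x"
  \<comment> \<open>Over the end points both profiles vanish, and the closed inequalities squeeze
    \<open>y\<close> to 0. Over interior points one of the strict inequalities must fail.\<close>
  proof (cases "x = a \<or> x = b")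
    case True
    then show ?thesis using closure_domain[OF c] ends by auto
  next
    case False
    then show ?thesis using closure_domain[OF c] n by (auto simp: thin_domain_def)
  qed
  then show "V \<epsilon> (x, y) = 0" by (auto simp: V_def)
qed

text \<open>Supplies a frontier point over every interior \<open>x\<close>, obtained as the limit of
  points of the domain directly below it. These serve as test points over a maximizer of the width
  and as an approach to the corners.\<close>

lemma upper_graph_frontier:
  assumes "\<epsilon> > 0" "a < x" "x < b"
  shows "(x, \<epsilon> * f2 x) \<in> frontier (\<Omega> \<epsilon>)"
proof -
  have w: "\<epsilon> * (f2 x - f1 x) > 0" using less assms by simp
  have "((\<lambda>t. (x, \<epsilon> * f2 x - t)) \<longlongrightarrow> (x, \<epsilon> * f2 x - 0)) (at_right 0)"
    by (intro tendsto_intros)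
  moreover have "\<forall>\<^sub>F t in at_right 0. (x, \<epsilon> * f2 x - t) \<in> closure (\<Omega> \<epsilon>)"
    using eventually_at_right_real[OF w]
  proof eventually_elim
    case (elim t)
    then have "(x, \<epsilon> * f2 x - t) \<in> \<Omega> \<epsilon>"
      using assms by (auto simp: thin_domain_def algebra_simps)
    then show ?case using closure_subset by blast
  qed
  ultimately have "(x, \<epsilon> * f2 x) \<in> closure (\<Omega> \<epsilon>)"
    using Lim_in_closed_set[of "closure (\<Omega> \<epsilon>)" _ "at_right (0::real)"] by fastforce
  moreover have "(x, \<epsilon> * f2 x) \<notin> \<Omega> \<epsilon>" by (auto simp: thin_domain_def)
  ultimately show ?thesis using open_domain[OF assms(1)] by (simp add: frontier_def interior_open)
qed

section \<open>The barrier and its comparison with the torsion function\<close>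

text \<open>Every term of the second derivative in \<open>x\<close> has order
  \<open>\<epsilon>\<^sup>2\<close>: one factor \<open>\<epsilon>\<close> comes from differentiating
  a profile, the other from a second differentiated profile or from a remaining factor of
  \<open>V\<close>, which is itself of order \<open>\<epsilon>\<close> in the domain.\<close>

lemma V_deriv2_x:
  assumes "\<epsilon> > 0" "(x, y) \<in> \<Omega> \<epsilon>"
  obtains \<rho> where "has_deriv2 (\<lambda>s. V \<epsilon> (s, y)) \<rho> x" "\<bar>\<rho>\<bar> < 8 * K\<^sup>2 * \<epsilon>\<^sup>2"
proof -
  define A B where "A = \<epsilon> * f2 x - y" and "B = y - \<epsilon> * f1 x"
  have x: "a < x" "x < b" and AB: "A > 0" "B > 0"
    using assms(2) by (auto simp: thin_domain_def A_def B_def)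
  \<comment> \<open>Both factors are positive, so each is at most their sum, the local
    width.\<close>
  have "A + B = \<epsilon> * (f2 x - f1 x)" by (simp add: A_def B_def algebra_simps)
  also have "\<dots> \<le> \<epsilon> * (2 * K)"
    using K(1)[of x] K(4)[of x] x assms(1) by (intro mult_left_mono) auto
  finally have AB': "\<bar>A\<bar> \<le> \<epsilon> * (2 * K)" "\<bar>B\<bar> \<le> \<epsilon> * (2 * K)" using AB by auto
  define \<rho> where "\<rho> = \<epsilon> * (f2'' x * B) - \<epsilon> * (f1'' x * A) - 2 * \<epsilon>\<^sup>2 * (f1' x * f2' x)"
  have "has_deriv2 (\<lambda>s. V \<epsilon> (s, y)) \<rho> x"
    unfolding has_deriv2_def
  proof (intro exI conjI)
    let ?g = "\<lambda>s. \<epsilon> * f2' s * (y - \<epsilon> * f1 s) - (\<epsilon> * f2 s - y) * (\<epsilon> * f1' s)"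
    have "\<forall>\<^sub>F s in nhds x. s \<in> {a<..<b}"
      using x by (intro eventually_nhds_in_open) auto
    then show "\<forall>\<^sub>F s in nhds x. ((\<lambda>s. V \<epsilon> (s, y)) has_real_derivative ?g s) (at s)"
    proof eventually_elim
      case (elim s)
      then show ?case unfolding V_def using derivs[of s]
        by (auto intro!: derivative_eq_intros)
    qed
    show "(?g has_real_derivative \<rho>) (at x)"
      using derivs[OF x]
      by (auto intro!: derivative_eq_intros simp: \<rho>_def A_def B_def algebra_simps power2_eq_square)
  qed
  moreover have "\<bar>\<rho>\<bar> < 8 * K\<^sup>2 * \<epsilon>\<^sup>2"
  proof -
    have xm: "x \<in> {a..b}" using x by auto
    have 1: "\<bar>f2'' x * B\<bar> \<le> K * (\<epsilon> * (2 * K))" "\<bar>f1'' x * A\<bar> \<le> K * (\<epsilon> * (2 * K))"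
      "\<bar>f1' x * f2' x\<bar> \<le> K * K"
      unfolding abs_mult
      using mult_mono[OF K(6)[OF xm] AB'(2)] mult_mono[OF K(3)[OF xm] AB'(1)]
        mult_mono[OF K(2)[OF xm] K(5)[OF xm]] K_pos by auto
    have "\<bar>\<rho>\<bar> \<le> \<bar>\<epsilon> * (f2'' x * B)\<bar> + \<bar>\<epsilon> * (f1'' x * A)\<bar> + \<bar>2 * \<epsilon>\<^sup>2 * (f1' x * f2' x)\<bar>"
      unfolding \<rho>_def by linarith
    also have "\<dots> = \<epsilon> * \<bar>f2'' x * B\<bar> + \<epsilon> * \<bar>f1'' x * A\<bar> + 2 * \<epsilon>\<^sup>2 * \<bar>f1' x * f2' x\<bar>"
      using assms(1) by (simp only: abs_mult abs_power2 abs_numeral abs_of_pos)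
    also have "\<dots> \<le> \<epsilon> * (K * (\<epsilon> * (2 * K))) + \<epsilon> * (K * (\<epsilon> * (2 * K))) + 2 * \<epsilon>\<^sup>2 * (K * K)"
      using 1 assms(1) by (intro add_mono mult_left_mono) auto
    also have "\<dots> = 6 * K\<^sup>2 * \<epsilon>\<^sup>2" by (simp add: power2_eq_square)
    \<comment> \<open>Enlarging 6 to 8 makes the bound strict, as the maximum principle will
      require. The new bound is twice \<open>4 * K\<^sup>2 * \<epsilon>\<^sup>2\<close>, the
      relative error in all later estimates.\<close>
    also have "\<dots> < 8 * K\<^sup>2 * \<epsilon>\<^sup>2" using assms(1) K_pos by simp
    finally show ?thesis .
  qed
  ultimately show ?thesis by (rule that)
qed

lemma V_deriv2_y: "has_deriv2 (\<lambda>s. V \<epsilon> (x, s)) (- 2) y"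
  unfolding has_deriv2_def
proof (intro exI conjI)
  let ?g = "\<lambda>s. (\<epsilon> * f2 x - s) - (s - \<epsilon> * f1 x)"
  show "\<forall>\<^sub>F s in nhds y. ((\<lambda>s. V \<epsilon> (x, s)) has_real_derivative ?g s) (at s)"
    unfolding V_def by (intro always_eventually allI) (auto intro!: derivative_eq_intros)
  show "(?g has_real_derivative - 2) (at y)"
    by (auto intro!: derivative_eq_intros)
qed

text \<open>The function \<open>c * u - d * V \<epsilon>\<close> vanishes on the frontier and has
  Laplacian \<open>d * (2 - \<rho>) - c\<close>, which \<open>sign\<close> makes positive, so the
  maximum principle applies. Since \<open>c\<close> and \<open>d\<close> may be negative, one
  statement covers upper and lower barriers.\<close>

lemma torsion_comparison:
  assumes e: "\<epsilon> > 0" and tor: "torsion_function (\<Omega> \<epsilon>) u"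
    and sign: "\<And>\<rho>. \<bar>\<rho>\<bar> < 8 * K\<^sup>2 * \<epsilon>\<^sup>2 \<Longrightarrow> d * (2 - \<rho>) > c" and "p \<in> \<Omega> \<epsilon>"
  shows "c * u p \<le> d * V \<epsilon> p"
proof -
  have "closure (\<Omega> \<epsilon>) \<subseteq> {a..b} \<times> UNIV"
    using closure_domain by (force simp: mem_Times_iff)
  then have cV: "continuous_on (closure (\<Omega> \<epsilon>)) (V \<epsilon>)"
    using cont_V continuous_on_subset by blast
  have "c * u p + (- d) * V \<epsilon> p \<le> 0"
  proof (rule weak_maximum_principle[OF open_domain[OF e] bounded_domain[OF e] _ _ _ \<open>p \<in> \<Omega> \<epsilon>\<close>,
        where \<phi> = "\<lambda>p. c * u p + (- d) * V \<epsilon> p"])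
    show "continuous_on (closure (\<Omega> \<epsilon>)) (\<lambda>p. c * u p + (- d) * V \<epsilon> p)"
      using tor cV unfolding torsion_function_def by (intro continuous_intros) auto
    show "c * u q + (- d) * V \<epsilon> q \<le> 0" if "q \<in> frontier (\<Omega> \<epsilon>)" for q
      using that tor frontier_domain(3)[OF e, of "fst q" "snd q"]
      by (simp add: torsion_function_def)
  next
    fix x y assume xy: "(x, y) \<in> \<Omega> \<epsilon>"
    obtain h1 h2 where h: "has_deriv2 (\<lambda>s. u (s, y)) h1 x" "has_deriv2 (\<lambda>s. u (x, s)) h2 y"
      "h1 + h2 = - 1" using torsion_function_deriv2[OF open_domain[OF e] tor xy] by blast
    obtain \<rho> where r: "has_deriv2 (\<lambda>s. V \<epsilon> (s, y)) \<rho> x" "\<bar>\<rho>\<bar> < 8 * K\<^sup>2 * \<epsilon>\<^sup>2"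
      using V_deriv2_x[OF e xy] by blast
    have "(c * h1 + (- d) * \<rho>) + (c * h2 + (- d) * (- 2)) = c * (h1 + h2) + d * (2 - \<rho>)"
      by (simp add: algebra_simps)
    also have "\<dots> > 0" using sign[OF r(2)] h(3) by simp
    finally show "\<exists>h1 h2. has_deriv2 (\<lambda>s. c * u (s, y) + (- d) * V \<epsilon> (s, y)) h1 x \<and>
        has_deriv2 (\<lambda>s. c * u (x, s) + (- d) * V \<epsilon> (x, s)) h2 y \<and> 0 < h1 + h2"
      using has_deriv2_lincomb[OF h(1) r(1)] has_deriv2_lincomb[OF h(2) V_deriv2_y] by blast
  qed
  then show ?thesis by simp
qed

text \<open>With \<open>\<kappa> = 4 * K\<^sup>2 * \<epsilon>\<^sup>2\<close> the quantity
  \<open>2 - \<rho>\<close> lies strictly between \<open>2 * (1 - \<kappa>)\<close> and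
  \<open>2 * (1 + \<kappa>)\<close>. The reciprocals of these two numbers are the coefficients; the
  lower bound uses the comparison with both signs reversed.\<close>

lemma torsion_bounds:
  assumes e: "\<epsilon> > 0" and tor: "torsion_function (\<Omega> \<epsilon>) u" and "p \<in> \<Omega> \<epsilon>"
    and small: "4 * K\<^sup>2 * \<epsilon>\<^sup>2 < 1"
  shows "1 / (2 * (1 + 4 * K\<^sup>2 * \<epsilon>\<^sup>2)) * V \<epsilon> p \<le> u p"
    and "u p \<le> 1 / (2 * (1 - 4 * K\<^sup>2 * \<epsilon>\<^sup>2)) * V \<epsilon> p"
proof -
  define \<kappa> where "\<kappa> = 4 * K\<^sup>2 * \<epsilon>\<^sup>2"
  have k: "\<kappa> \<ge> 0" "\<kappa> < 1" using small by (auto simp: \<kappa>_def)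
  have "1 * u p \<le> 1 / (2 * (1 - \<kappa>)) * V \<epsilon> p"
    by (rule torsion_comparison[OF e tor _ \<open>p \<in> \<Omega> \<epsilon>\<close>]) (use k in \<open>auto simp: \<kappa>_def field_simps\<close>)
  then show "u p \<le> 1 / (2 * (1 - 4 * K\<^sup>2 * \<epsilon>\<^sup>2)) * V \<epsilon> p" by (simp add: \<kappa>_def)
  have "- 1 * u p \<le> - (1 / (2 * (1 + \<kappa>))) * V \<epsilon> p"
    by (rule torsion_comparison[OF e tor _ \<open>p \<in> \<Omega> \<epsilon>\<close>]) (use k in \<open>auto simp: \<kappa>_def field_simps\<close>)
  then show "1 / (2 * (1 + 4 * K\<^sup>2 * \<epsilon>\<^sup>2)) * V \<epsilon> p \<le> u p" by (simp add: \<kappa>_def)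
qed

section \<open>Size of the gradient on the frontier\<close>

text \<open>On the frontier one factor of \<open>V\<close> is 0 and the other is the width
  \<open>W\<close>. Hence the gradient \<open>N\<close> of \<open>V\<close> has vertical part of
  size \<open>W\<close> and horizontal part at most \<open>W * (\<epsilon> * K)\<close>, and the two
  barriers carry this over to \<open>G\<close>.\<close>

lemma boundary_gradient:
  assumes e: "\<epsilon> > 0" and tor: "torsion_function (\<Omega> \<epsilon>) u"
    and grad: "gradient_up_to_boundary (\<Omega> \<epsilon>) u G"
    and small: "4 * K\<^sup>2 * \<epsilon>\<^sup>2 < 1"
    and x: "a < x" "x < b" and fr: "(x, y) \<in> frontier (\<Omega> \<epsilon>)"
  shows "\<epsilon> * (f2 x - f1 x) / (2 * (1 + 4 * K\<^sup>2 * \<epsilon>\<^sup>2)) \<le> norm (G (x, y))"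
    and "norm (G (x, y)) \<le> \<epsilon> * (f2 x - f1 x) * (1 + \<epsilon> * K) / (2 * (1 - 4 * K\<^sup>2 * \<epsilon>\<^sup>2))"
proof -
  define W where "W = \<epsilon> * (f2 x - f1 x)"
  have W: "W > 0" using less[OF x] e by (simp add: W_def)
  define A B where "A = \<epsilon> * f2 x - y" and "B = y - \<epsilon> * f1 x"
  define N where "N = (\<epsilon> * f2' x * B - A * (\<epsilon> * f1' x), A - B)"
  have AB: "A = 0 \<and> B = W \<or> A = W \<and> B = 0"
    using frontier_domain(2)[OF e fr] by (auto simp: A_def B_def W_def algebra_simps)
  have d1: "((\<lambda>p. f1 (fst p)) has_derivative (\<lambda>h. f1' x * fst h)) (at (x, y))"
    using has_derivative_compose[OF has_derivative_fst[OF has_derivative_ident], of f1 "(*) (f1' x)" "(x, y)"]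
      derivs(1)[OF x] by (simp add: has_field_derivative_def)
  have d2: "((\<lambda>p. f2 (fst p)) has_derivative (\<lambda>h. f2' x * fst h)) (at (x, y))"
    using has_derivative_compose[OF has_derivative_fst[OF has_derivative_ident], of f2 "(*) (f2' x)" "(x, y)"]
      derivs(3)[OF x] by (simp add: has_field_derivative_def)
  have VN: "GDERIV (V \<epsilon>) (x, y) :> N"
    unfolding gderiv_def V_def
    by (rule derivative_eq_intros d1 d2 refl)+
       (auto simp: fun_eq_iff N_def A_def B_def inner_prod_def algebra_simps)
  have "\<bar>f1' x\<bar> \<le> K" "\<bar>f2' x\<bar> \<le> K" using K[of x] x by auto
  then have N1: "\<bar>fst N\<bar> \<le> W * (\<epsilon> * K)"
    using AB e W by (auto simp: N_def abs_mult mult.commute[of _ W])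
  have N2: "\<bar>snd N\<bar> = W" using AB W by (auto simp: N_def)
  have Nlow: "W \<le> norm N" using norm_snd_le[of "snd N" "fst N"] N2 by simp
  have Nup: "norm N \<le> W * (1 + \<epsilon> * K)"
    using norm_Pair_le[of "fst N" "snd N"] N1 N2 by (simp add: algebra_simps)
  have pos: "\<forall>\<^sub>F q in nhds (x, y). 0 < V \<epsilon> q \<longrightarrow> q \<in> \<Omega> \<epsilon>"
  proof -
    have "\<forall>\<^sub>F q in nhds (x, y). q \<in> {a<..<b} \<times> UNIV"
      using x by (intro eventually_nhds_in_open open_Times) auto
    then show ?thesis by eventually_elim (auto simp: mem_iff[OF e])
  qed
  have u: "continuous_on (closure (\<Omega> \<epsilon>)) u" "u (x, y) = 0" "(x, y) \<in> closure (\<Omega> \<epsilon>)"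
    using tor fr by (auto simp: torsion_function_def frontier_def)
  have cp: "1 / (2 * (1 + 4 * K\<^sup>2 * \<epsilon>\<^sup>2)) > 0" by (simp add: add_pos_nonneg)
  have dp: "1 / (2 * (1 - 4 * K\<^sup>2 * \<epsilon>\<^sup>2)) > 0" using small by simp
  have N0: "N \<noteq> 0" using Nlow W by auto
  note bounds = boundary_gradient_bounds[OF open_domain[OF e] grad u(1,3,2) VN
      frontier_domain(3)[OF e fr] N0 pos torsion_bounds[OF e tor _ small] cp]
  show "\<epsilon> * (f2 x - f1 x) / (2 * (1 + 4 * K\<^sup>2 * \<epsilon>\<^sup>2)) \<le> norm (G (x, y))"
    using mult_left_mono[OF Nlow less_imp_le[OF cp]] bounds(1) by (simp add: W_def)
  show "norm (G (x, y)) \<le> \<epsilon> * (f2 x - f1 x) * (1 + \<epsilon> * K) / (2 * (1 - 4 * K\<^sup>2 * \<epsilon>\<^sup>2))"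
    using mult_left_mono[OF Nup less_imp_le[OF dp]] bounds(2) by (simp add: W_def)
qed

text \<open>Along the upper graph the upper estimate for the norm of \<open>G\<close> is
  proportional to the width, which tends to 0 at a corner; continuity of \<open>G\<close> on the
  closure passes this to the corner itself.\<close>

lemma corner_gradient:
  assumes e: "\<epsilon> > 0" and tor: "torsion_function (\<Omega> \<epsilon>) u"
    and grad: "gradient_up_to_boundary (\<Omega> \<epsilon>) u G"
    and small: "4 * K\<^sup>2 * \<epsilon>\<^sup>2 < 1"
    and x: "x = a \<or> x = b" and fr: "(x, y) \<in> frontier (\<Omega> \<epsilon>)"
  shows "G (x, y) = 0"
proof -
  let ?F = "at x within {a<..<b}"
  have nt: "?F \<noteq> bot"
    using x ab by (auto simp: trivial_limit_within islimpt_greaterThanLessThan1 islimpt_greaterThanLessThan2)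
  have xm: "x \<in> {a..b}" using x ab by auto
  have "(f1 \<longlongrightarrow> f1 x) (at x within {a..b})" "(f2 \<longlongrightarrow> f2 x) (at x within {a..b})"
    using cont xm by (auto simp: continuous_on_def)
  then have lim: "(f1 \<longlongrightarrow> f1 x) ?F" "(f2 \<longlongrightarrow> f2 x) ?F"
    using tendsto_within_subset[of _ _ x "{a..b}" "{a<..<b}"] greaterThanLessThan_subseteq_atLeastAtMost_iff
    by (metis order_refl)+
  have z: "f1 x = 0" "f2 x = 0" using x ends by auto
  have y: "y = \<epsilon> * f2 x" using frontier_domain(2)[OF e fr] z by auto
  have ev: "\<forall>\<^sub>F s in ?F. s \<in> {a<..<b}" by (simp add: eventually_at_filter)
  have "((\<lambda>s. G (s, \<epsilon> * f2 s)) \<longlongrightarrow> G (x, y)) ?F"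
  proof (rule continuous_on_tendsto_compose[of "closure (\<Omega> \<epsilon>)" G "\<lambda>s. (s, \<epsilon> * f2 s)"])
    show "continuous_on (closure (\<Omega> \<epsilon>)) G"
      using grad by (simp add: gradient_up_to_boundary_def)
    show "((\<lambda>s. (s, \<epsilon> * f2 s)) \<longlongrightarrow> (x, y)) ?F"
      unfolding y by (intro tendsto_intros lim)
    show "(x, y) \<in> closure (\<Omega> \<epsilon>)" using fr by (simp add: frontier_def)
    show "\<forall>\<^sub>F s in ?F. (s, \<epsilon> * f2 s) \<in> closure (\<Omega> \<epsilon>)"
      using ev by eventually_elim (use upper_graph_frontier[OF e] in \<open>auto simp: frontier_def\<close>)
  qed
  then have 1: "((\<lambda>s. norm (G (s, \<epsilon> * f2 s))) \<longlongrightarrow> norm (G (x, y))) ?F" by (rule tendsto_norm)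
  have "((\<lambda>s. \<epsilon> * (f2 s - f1 s) * (1 + \<epsilon> * K) / (2 * (1 - 4 * K\<^sup>2 * \<epsilon>\<^sup>2)))
      \<longlongrightarrow> \<epsilon> * (f2 x - f1 x) * (1 + \<epsilon> * K) / (2 * (1 - 4 * K\<^sup>2 * \<epsilon>\<^sup>2))) ?F"
    using small by (intro tendsto_intros lim) auto
  then have 2: "((\<lambda>s. \<epsilon> * (f2 s - f1 s) * (1 + \<epsilon> * K) / (2 * (1 - 4 * K\<^sup>2 * \<epsilon>\<^sup>2))) \<longlongrightarrow> 0) ?F"
    by (simp add: z)
  have "\<forall>\<^sub>F s in ?F. norm (G (s, \<epsilon> * f2 s))
      \<le> \<epsilon> * (f2 s - f1 s) * (1 + \<epsilon> * K) / (2 * (1 - 4 * K\<^sup>2 * \<epsilon>\<^sup>2))"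
    using ev
    by eventually_elim
      (use boundary_gradient(2)[OF e tor grad small] upper_graph_frontier[OF e] in auto)
  then have "norm (G (x, y)) \<le> 0" by (rule tendsto_le[OF nt 2 1])
  then show ?thesis by simp
qed

section \<open>Locating the fail points\<close>

text \<open>The lower gradient estimate at the test point \<open>(m, \<epsilon> * f2 m)\<close> is
  set against the upper estimate at the fail point. The common factor \<open>\<epsilon> / 2\<close>
  cancels, leaving a comparison of widths up to factors that tend to 1.\<close>

lemma fail_point_near_max:
  assumes e: "\<epsilon> > 0" and small: "4 * K\<^sup>2 * \<epsilon>\<^sup>2 < 1"
    and fail: "fail_point (\<Omega> \<epsilon>) (x, y)" and m: "a < m" "m < b"
  shows "(f2 m - f1 m) * (1 - 4 * K\<^sup>2 * \<epsilon>\<^sup>2) \<le> (f2 x - f1 x) * ((1 + 4 * K\<^sup>2 * \<epsilon>\<^sup>2) * (1 + \<epsilon> * K))"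
    and "x \<in> {a<..<b}"
proof -
  obtain u G where tor: "torsion_function (\<Omega> \<epsilon>) u" and grad: "gradient_up_to_boundary (\<Omega> \<epsilon>) u G"
    and fr: "(x, y) \<in> frontier (\<Omega> \<epsilon>)"
    and max: "\<And>q. q \<in> frontier (\<Omega> \<epsilon>) \<Longrightarrow> norm (G q) \<le> norm (G (x, y))"
    using fail unfolding fail_point_def by blast
  define \<kappa> where "\<kappa> = 4 * K\<^sup>2 * \<epsilon>\<^sup>2"
  have k: "\<kappa> \<ge> 0" "\<kappa> < 1" using small by (auto simp: \<kappa>_def)
  have frm: "(m, \<epsilon> * f2 m) \<in> frontier (\<Omega> \<epsilon>)" by (rule upper_graph_frontier[OF e m])
  have low: "\<epsilon> * (f2 m - f1 m) / (2 * (1 + \<kappa>)) \<le> norm (G (x, y))"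
    using boundary_gradient(1)[OF e tor grad small m frm] max[OF frm] by (simp add: \<kappa>_def)
  have "\<epsilon> * (f2 m - f1 m) / (2 * (1 + \<kappa>)) > 0" using k e less[OF m] by simp
  then have "G (x, y) \<noteq> 0" using low by auto
  \<comment> \<open>A corner has zero gradient, whereas the maximal gradient is at least the
    positive one at the test point.\<close>
  then show x: "x \<in> {a<..<b}"
    using corner_gradient[OF e tor grad small _ fr] frontier_domain(1)[OF e fr] by force
  have "\<epsilon> * (f2 m - f1 m) / (2 * (1 + \<kappa>)) \<le> \<epsilon> * (f2 x - f1 x) * (1 + \<epsilon> * K) / (2 * (1 - \<kappa>))"
    using low boundary_gradient(2)[OF e tor grad small _ _ fr] x by (simp add: \<kappa>_def)
  then have "\<epsilon> * (f2 m - f1 m) * (2 * (1 - \<kappa>)) \<le> \<epsilon> * (f2 x - f1 x) * (1 + \<epsilon> * K) * (2 * (1 + \<kappa>))"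
    using k by (simp add: pos_divide_le_eq pos_le_divide_eq mult.assoc del: mult_le_cancel_left mult_le_cancel_left_pos)
  moreover have "\<epsilon> * (f2 m - f1 m) * (2 * (1 - \<kappa>)) = 2 * (\<epsilon> * ((f2 m - f1 m) * (1 - \<kappa>)))"
    "\<epsilon> * (f2 x - f1 x) * (1 + \<epsilon> * K) * (2 * (1 + \<kappa>))
      = 2 * (\<epsilon> * ((f2 x - f1 x) * ((1 + \<kappa>) * (1 + \<epsilon> * K))))"
    by algebra+
  ultimately have "\<epsilon> * ((f2 m - f1 m) * (1 - \<kappa>)) \<le> \<epsilon> * ((f2 x - f1 x) * ((1 + \<kappa>) * (1 + \<epsilon> * K)))"
    by linarith
  then show "(f2 m - f1 m) * (1 - 4 * K\<^sup>2 * \<epsilon>\<^sup>2) \<le> (f2 x - f1 x) * ((1 + 4 * K\<^sup>2 * \<epsilon>\<^sup>2) * (1 + \<epsilon> * K))"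
    using e by (simp add: \<kappa>_def)
qed

text \<open>The points of \<open>{a..b}\<close> at distance at least \<open>\<eta>\<close> from the
  maximizers form a compact set, on which the width stays below some \<open>M'\<close> smaller than
  its maximum. For small \<open>\<epsilon>\<close> this gap exceeds the error in
  \<open>fail_point_near_max\<close>.\<close>

theorem fail_points_converge:
  assumes "\<eta> > 0"
  shows "\<exists>\<epsilon>0>0. \<forall>\<epsilon>. 0 < \<epsilon> \<and> \<epsilon> < \<epsilon>0 \<longrightarrow>
           (\<forall>x y. fail_point (\<Omega> \<epsilon>) (x, y) \<longrightarrow>
                  infdist x (argmax_set {a..b} (\<lambda>t. f2 t - f1 t)) < \<eta>)"
proof -
  define w where "w t = f2 t - f1 t" for t
  have cw: "continuous_on {a..b} w" unfolding w_def by (intro continuous_intros cont)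
  obtain m where m: "m \<in> {a..b}" "\<And>t. t \<in> {a..b} \<Longrightarrow> w t \<le> w m"
    using continuous_attains_sup[OF _ _ cw] ab by (metis atLeastAtMost_iff compact_Icc empty_iff less_imp_le order_refl)
  \<comment> \<open>The midpoint shows that the maximal width is positive, so the maximizer
    \<open>m\<close> is interior and can serve as a test point.\<close>
  have "w ((a + b) / 2) > 0" using less[of "(a + b) / 2"] ab by (simp add: w_def)
  moreover have "w ((a + b) / 2) \<le> w m" using ab by (intro m) auto
  ultimately have "w m > 0" by simp
  then have "m \<noteq> a" "m \<noteq> b" using ends by (auto simp: w_def)
  then have mi: "a < m" "m < b" using m(1) by auto
  let ?I = "argmax_set {a..b} w"
  let ?S = "{x \<in> {a..b}. infdist x ?I \<ge> \<eta>}"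
  have "?S = {a..b} \<inter> (\<lambda>x. infdist x ?I) -` {\<eta>..}" by auto
  also have "closed \<dots>"
    by (intro continuous_closed_preimage continuous_intros)
  finally have "closed ?S" .
  moreover have "bounded ?S" by (rule bounded_subset[OF bounded_closed_interval[of a b]]) auto
  ultimately have comp: "compact ?S" by (simp add: compact_eq_bounded_closed)
  have "\<exists>M'<w m. \<forall>x\<in>?S. w x \<le> M'"
  proof (cases "?S = {}")
    \<comment> \<open>No point is that far from the maximizers, so any number below
      \<open>w m\<close> serves.\<close>
    case True
    then show ?thesis using lt_ex by blast
  next
    case False
    obtain z where z: "z \<in> ?S" "\<And>x. x \<in> ?S \<Longrightarrow> w x \<le> w z"
      using continuous_attains_sup[OF comp False continuous_on_subset[OF cw]] by blast
    have "z \<notin> ?I" using z(1) \<open>\<eta> > 0\<close> infdist_zero by force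
    then obtain t where "t \<in> {a..b}" "w z < w t" using z(1) by (auto simp: argmax_set_def not_le)
    then have "w z < w m" using m(2)[of t] by simp
    then show ?thesis using z by blast
  qed
  then obtain M' where M': "M' < w m" "\<And>x. x \<in> ?S \<Longrightarrow> w x \<le> M'" by blast
  \<comment> \<open>The limit at \<open>\<epsilon> = 0\<close> is \<open>w m - M'\<close>, which is
    positive; the same sign therefore holds for all small \<open>\<epsilon>\<close>.\<close>
  have "((\<lambda>\<epsilon>. w m * (1 - 4 * K\<^sup>2 * \<epsilon>\<^sup>2) - M' * ((1 + 4 * K\<^sup>2 * \<epsilon>\<^sup>2) * (1 + \<epsilon> * K)))
      \<longlongrightarrow> w m * (1 - 4 * K\<^sup>2 * 0\<^sup>2) - M' * ((1 + 4 * K\<^sup>2 * 0\<^sup>2) * (1 + 0 * K))) (at_right 0)"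
    by (intro tendsto_intros)
  then have ev1: "\<forall>\<^sub>F \<epsilon> in at_right 0.
      0 < w m * (1 - 4 * K\<^sup>2 * \<epsilon>\<^sup>2) - M' * ((1 + 4 * K\<^sup>2 * \<epsilon>\<^sup>2) * (1 + \<epsilon> * K))"
    by (rule order_tendstoD) (use M' in simp)
  have "((\<lambda>\<epsilon>. 4 * K\<^sup>2 * \<epsilon>\<^sup>2) \<longlongrightarrow> 4 * K\<^sup>2 * 0\<^sup>2) (at_right 0)"
    by (intro tendsto_intros)
  then have ev2: "\<forall>\<^sub>F \<epsilon> in at_right 0. 4 * K\<^sup>2 * \<epsilon>\<^sup>2 < 1"
    by (rule order_tendstoD) simp
  obtain \<epsilon>0 where e0: "\<epsilon>0 > 0" "\<And>\<epsilon>. 0 < \<epsilon> \<Longrightarrow> \<epsilon> < \<epsilon>0 \<Longrightarrow>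
      M' * ((1 + 4 * K\<^sup>2 * \<epsilon>\<^sup>2) * (1 + \<epsilon> * K)) < w m * (1 - 4 * K\<^sup>2 * \<epsilon>\<^sup>2) \<and> 4 * K\<^sup>2 * \<epsilon>\<^sup>2 < 1"
    using eventually_conj[OF ev1 ev2] unfolding eventually_at_right_field by auto
  have "infdist x ?I < \<eta>" if e: "0 < \<epsilon>" "\<epsilon> < \<epsilon>0" and fail: "fail_point (\<Omega> \<epsilon>) (x, y)" for \<epsilon> x y
  proof (rule ccontr)
    note E = e0(2)[OF e]
    note near = fail_point_near_max[OF e(1) conjunct2[OF E] fail mi, folded w_def]
    assume "\<not> infdist x ?I < \<eta>"
    then have "w x \<le> M'" using near(2) by (intro M') auto
    moreover have "0 \<le> (1 + 4 * K\<^sup>2 * \<epsilon>\<^sup>2) * (1 + \<epsilon> * K)"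
      using e K_pos by (intro mult_nonneg_nonneg add_nonneg_nonneg) auto
    ultimately have "w x * ((1 + 4 * K\<^sup>2 * \<epsilon>\<^sup>2) * (1 + \<epsilon> * K)) \<le> M' * ((1 + 4 * K\<^sup>2 * \<epsilon>\<^sup>2) * (1 + \<epsilon> * K))"
      by (rule mult_right_mono)
    then show False using near(1) E by linarith
  qed
  then show ?thesis using e0(1) unfolding w_def by blast
qed

end

section \<open>From twice continuously differentiable profiles to uniform bounds\<close>

lemma C2_on_Icc_bounded:
  assumes "C2_on_Icc a b f"
  obtains f' f'' B where
    "\<And>x. x \<in> {a..b} \<Longrightarrow> (f has_real_derivative f' x) (at x within {a..b})"
    "\<And>x. x \<in> {a..b} \<Longrightarrow> (f' has_real_derivative f'' x) (at x within {a..b})"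
    "\<And>x. x \<in> {a..b} \<Longrightarrow> \<bar>f x\<bar> \<le> B \<and> \<bar>f' x\<bar> \<le> B \<and> \<bar>f'' x\<bar> \<le> B"
proof -
  obtain f' f'' where
    d: "\<And>x. x \<in> {a..b} \<Longrightarrow> (f has_real_derivative f' x) (at x within {a..b})"
      "\<And>x. x \<in> {a..b} \<Longrightarrow> (f' has_real_derivative f'' x) (at x within {a..b})"
    and c: "continuous_on {a..b} f''"
    using assms unfolding C2_on_Icc_def by blast
  have bdd: "\<exists>B. \<forall>x\<in>{a..b}. \<bar>g x\<bar> \<le> B" if "continuous_on {a..b} g" for g :: "real \<Rightarrow> real"
    using compact_imp_bounded[OF compact_continuous_image[OF that compact_Icc]]
    unfolding bounded_iff by auto
  obtain B0 B1 B2 where "\<forall>x\<in>{a..b}. \<bar>f x\<bar> \<le> B0" "\<forall>x\<in>{a..b}. \<bar>f' x\<bar> \<le> B1" "\<forall>x\<in>{a..b}. \<bar>f'' x\<bar> \<le> B2"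
    using bdd[OF DERIV_continuous_on[OF d(1)]] bdd[OF DERIV_continuous_on[OF d(2)]] bdd[OF c] by blast
  then have "\<bar>f x\<bar> \<le> max B0 (max B1 B2) \<and> \<bar>f' x\<bar> \<le> max B0 (max B1 B2) \<and> \<bar>f'' x\<bar> \<le> max B0 (max B1 B2)"
    if "x \<in> {a..b}" for x using that by (auto simp: le_max_iff_disj)
  then show ?thesis using that d by blast
qed

theorem theorem1p1:
  fixes a b :: real and f1 f2 :: "real \<Rightarrow> real"
  assumes "a < b"
    and "C2_on_Icc a b f1" and "C2_on_Icc a b f2"
    and "f1 a = 0" and "f2 a = 0" and "f1 b = 0" and "f2 b = 0"
    and "\<And>x. a < x \<Longrightarrow> x < b \<Longrightarrow> f1 x < f2 x"
    and "convex_on {a..b} f1" and "concave_on {a..b} f2"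
  shows "\<forall>\<eta>>0. \<exists>\<epsilon>0>0. \<forall>\<epsilon>. 0 < \<epsilon> \<and> \<epsilon> < \<epsilon>0 \<longrightarrow>
           (\<forall>x y. fail_point (thin_domain a b f1 f2 \<epsilon>) (x, y) \<longrightarrow>
                  infdist x (argmax_set {a..b} (\<lambda>t. f2 t - f1 t)) < \<eta>)"
proof -
  obtain f1' f1'' B1 where 1:
    "\<And>x. x \<in> {a..b} \<Longrightarrow> (f1 has_real_derivative f1' x) (at x within {a..b})"
    "\<And>x. x \<in> {a..b} \<Longrightarrow> (f1' has_real_derivative f1'' x) (at x within {a..b})"
    "\<And>x. x \<in> {a..b} \<Longrightarrow> \<bar>f1 x\<bar> \<le> B1 \<and> \<bar>f1' x\<bar> \<le> B1 \<and> \<bar>f1'' x\<bar> \<le> B1"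
    using C2_on_Icc_bounded[OF assms(2)] by blast
  obtain f2' f2'' B2 where 2:
    "\<And>x. x \<in> {a..b} \<Longrightarrow> (f2 has_real_derivative f2' x) (at x within {a..b})"
    "\<And>x. x \<in> {a..b} \<Longrightarrow> (f2' has_real_derivative f2'' x) (at x within {a..b})"
    "\<And>x. x \<in> {a..b} \<Longrightarrow> \<bar>f2 x\<bar> \<le> B2 \<and> \<bar>f2' x\<bar> \<le> B2 \<and> \<bar>f2'' x\<bar> \<le> B2"
    using C2_on_Icc_bounded[OF assms(3)] by blast
  \<comment> \<open>The outer maximum merges the bounds for the two profiles; the entry 1 guarantees
    that \<open>K\<close> is positive.\<close>
  interpret thin_profile a b "max 1 (max B1 B2)" f1 f1' f1'' f2 f2' f2''
    by unfold_locales (use assms 1 2 in \<open>auto simp: le_max_iff_disj\<close>)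
  show ?thesis using fail_points_converge by blast
qed

end
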